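(* The number of connected components of $\Gamma(\Omega,q)$ is at least $q^{|\Omega^*|-\hbar(\Omega,q)}$.
   Context: Let $q$ be a prime power and $\mathbb{F}_q$ the field with $q$ elements. $\{0,1\}^*$ is the set of finite binary sequences, $\eta$ the null sequence; juxtaposition is concatenation; $\alpha^i$ is the $i$-fold concatenation of $\alpha$ ($\alpha^0=\eta$). $\Omega\subset\{0,1\}^*$ is a finite set satisfying condition C1: $\eta\in\Omega$, and for any $\alpha\in\Omega\setminus\{\eta\}$ the sequence obtained by deleting the last bit of $\alpha$ is in $\Omega$. $L(\Omega)$ and $R(\Omega)$ are two disjoint copies of $\mathbb{F}_q^{|\Omega|+1}$; their vectors are written $[l]$ and $\langle r\rangle$ respectively, with entries indexed by $\Omega\cup\{*\}$, where $*\notin\Omega$ is an extra symbol. $\Gamma(\Omega,q)$ is the bipartite graph with vertex set $L(\Omega)\cup R(\Omega)$ in which $[l]\in L(\Omega)$ and $\langle r\rangle\in R(\Omega)$ are adjacent if and only if $l_\eta+r_\eta=l_*r_*$, $l_{\alpha0}+r_{\alpha0}=r_*l_\alpha$ for all $\alpha0\in\Omega$, and $l_{\beta1}+r_{\beta1}=l_*r_\beta$ for all $\beta1\in\Omega$ (here $\alpha,\beta\in\{0,1\}^*$). By convention $*0=*1=\eta$ (so e.g. $*10^t=0^t$ and $*01^t=1^t$). $\Omega^*=\Omega\setminus\{\eta\}$. For $a\in\{0,1\}$ (also treated as an integer) and a sequence $\boldsymbol{s}=(s_1,s_2,\ldots)$ of nonnegative integers, put $\mu_{a,0}(\boldsymbol{s})=*$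 and, for $i\ge1$, $\mu_{a,i}(\boldsymbol{s})=\mu_{a,i-1}(\boldsymbol{s})10^{s_i}$ if $i+a$ is odd and $\mu_{a,i}(\boldsymbol{s})=\mu_{a,i-1}(\boldsymbol{s})01^{s_i}$ if $i+a$ is even. For $\alpha,\beta\in\Omega^*$ write $\alpha\bowtie_q\beta$ if there exist a positive integer $n$, sequences of nonnegative integers $\boldsymbol{s}=(s_1,\ldots,s_n,0)$, $\boldsymbol{s}'=(s'_1,\ldots,s'_n,0)$, $\boldsymbol{s}''=(s''_1,\ldots,s''_n,0)$ and $a,b\in\{0,1\}$ such that: $s_i\equiv s_i'\equiv s''_{n+1-i}\pmod{q-1}$ for $1\le i\le n$; $s_i=s_i'=s''_{n+1-i}$ whenever $1<i<n$ and $\min\{s_i,s_i',s''_{n+1-i}\}=0$; $a=b$ if and only if $n$ is odd; $\alpha=\mu_{a,n+1}(\boldsymbol{s})$; $\beta=\mu_{a,n+1}(\boldsymbol{s}')$ or $\beta=\mu_{b,n+1}(\boldsymbol{s}'')$; and, if $\boldsymbol{s}\ne\boldsymbol{s}'$ and $m$ is the smallest integer with $s_m\neq s_m'$, then $\mu_{b,n-m}(\boldsymbol{s}'')\in\Omega\cup\{*\}$. The relation $\bowtie_q$ is an equivalence relation on $\Omega^*$, and $\hbar(\Omega,q)$ denotes the number of its equivalence classes. *)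

theory Defs
  imports
    "HOL-Library.FuncSet"
    "HOL-Number_Theory.Cong"
    "Graph_Theory.Digraph_Component"
begin

section \<open>Binary sequences\<close>

text \<open>
  A finite binary sequence is a \<^typ>\<open>bool list\<close>, \<^const>\<open>False\<close> being the bit 0 and \<^const>\<open>True\<close> the
  bit 1, written from left to right; the null sequence is \<^term>\<open>[]\<close>. The type
  \<^typ>\<open>bool list option\<close> adjoins the extra symbol \<open>*\<close>, which is \<^const>\<open>None\<close>.
\<close>

definition condition_C1 :: "bool list set \<Rightarrow> bool" where
  "condition_C1 \<Omega> \<longleftrightarrow> [] \<in> \<Omega> \<and> (\<forall>\<alpha> \<in> \<Omega> - {[]}. butlast \<alpha> \<in> \<Omega>)"

definition nonnull :: "bool list set \<Rightarrow> bool list set" where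
  "nonnull \<Omega> = \<Omega> - {[]}"

definition with_star :: "bool list set \<Rightarrow> bool list option set" where
  "with_star \<Omega> = insert None (Some ` \<Omega>)"

section \<open>The bipartite graph\<close>

definition vectors :: "bool list set \<Rightarrow> (bool list option \<Rightarrow> 'a) set" where
  "vectors \<Omega> = with_star \<Omega> \<rightarrow>\<^sub>E UNIV"

definition adjacent ::
  "bool list set \<Rightarrow> (bool list option \<Rightarrow> 'a::field) \<Rightarrow> (bool list option \<Rightarrow> 'a) \<Rightarrow> bool" where
  "adjacent \<Omega> l r \<longleftrightarrow>
     l (Some []) + r (Some []) = l None * r None \<and>
     (\<forall>\<alpha>. \<alpha> @ [False] \<in> \<Omega> \<longrightarrow>
        l (Some (\<alpha> @ [False])) + r (Some (\<alpha> @ [False])) = r None * l (Some \<alpha>)) \<and>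
     (\<forall>\<beta>. \<beta> @ [True] \<in> \<Omega> \<longrightarrow>
        l (Some (\<beta> @ [True])) + r (Some (\<beta> @ [True])) = l None * r (Some \<beta>))"

text \<open>
  The two disjoint copies of the vector space are the two summands of a sum type. As in
  \<^theory>\<open>Graph_Theory.Digraph\<close>, an undirected graph is a symmetric digraph.
\<close>

definition \<Gamma> ::
  "bool list set \<Rightarrow>
   ((bool list option \<Rightarrow> 'a::field) + (bool list option \<Rightarrow> 'a)) pair_pre_digraph" where
  "\<Gamma> \<Omega> =
     \<lparr>pverts = Inl ` vectors \<Omega> \<union> Inr ` vectors \<Omega>,
      parcs = {(Inl l, Inr r) | l r. l \<in> vectors \<Omega> \<and> r \<in> vectors \<Omega> \<and> adjacent \<Omega> l r} \<union>
              {(Inr r, Inl l) | l r. l \<in> vectors \<Omega> \<and> r \<in> vectors \<Omega> \<and> adjacent \<Omega> l r}\<rparr>"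

lemma pair_graph_\<Gamma>:
  assumes "finite \<Omega>"
  shows "pair_graph (\<Gamma> \<Omega> :: (_ + (_ \<Rightarrow> 'a::{field,finite})) pair_pre_digraph)"
proof -
  have fin: "finite (vectors \<Omega> :: (_ \<Rightarrow> 'a) set)"
    unfolding vectors_def with_star_def using assms by (intro finite_PiE) auto
  let ?G = "\<Gamma> \<Omega> :: (_ + (_ \<Rightarrow> 'a)) pair_pre_digraph"
  have verts: "finite (pverts ?G)"
    using fin by (simp add: \<Gamma>_def)
  have arcs: "parcs ?G \<subseteq> pverts ?G \<times> pverts ?G"
    by (auto simp: \<Gamma>_def)
  have "finite (parcs ?G)"
    using verts arcs finite_subset by blast
  moreover have "symmetric (with_proj ?G)"
    by (auto simp: symmetric_def \<Gamma>_def intro!: symI)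
  moreover have "fst e \<noteq> snd e" if "e \<in> parcs ?G" for e
    using that by (auto simp: \<Gamma>_def)
  ultimately show ?thesis
    using verts arcs by unfold_locales auto
qed

definition connected_components :: "('v, 'e) pre_digraph \<Rightarrow> ('v, 'e) pre_digraph set" where
  "connected_components G = {H. pre_digraph.max_subgraph G Digraph_Component.connected H}"

lemma (in sym_digraph) connected_components_eq_sccs: "connected_components G = sccs"
proof -
  have strong: "\<exists>K. subgraph H K \<and> induced_subgraph K G \<and> strongly_connected K"
    if H: "subgraph H G" "Digraph_Component.connected H" for H
  proof (intro exI conjI)
    let ?K = "G \<restriction> verts H"
    show K: "induced_subgraph ?K G"
      using H(1) by (intro induced_induce) auto
    then interpret K: wf_digraph ?K
      by (rule wf_digraphI_induced)
    interpret H: wf_digraph H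
      using H(1) by auto
    show HK: "subgraph H ?K"
      using H(1) K H.wellformed unfolding subgraph_def compatible_def by auto
    have "spanning H ?K"
      using HK by (auto simp: spanning_def)
    then have "Digraph_Component.connected ?K"
      using H(2) by (rule K.connected_spanning_imp_connected)
    moreover have "symmetric ?K"
      using sym_arcs K by (rule induced_graph_imp_symmetric)
    ultimately show "strongly_connected ?K"
      by (rule K.symmetric_connected_imp_strongly_connected[rotated])
  qed
  have conn: "Digraph_Component.connected H" if "subgraph H G" "strongly_connected H" for H
  proof -
    interpret H: wf_digraph H
      using that(1) by auto
    show ?thesis
      using that(2) unfolding Digraph_Component.connected_def strongly_connected_def
      by (auto intro: H.reachable_mk_symmetricI)
  qed
  have sub: "subgraph K G" if "induced_subgraph K G" for K
    using that by (simp add: induced_subgraph_def)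
  have trans: "subgraph H K" if "subgraph H H'" "subgraph H' K"
    for H H' K :: "('a, 'b) pre_digraph"
    using that by (auto simp: subgraph_def compatible_def)
  have antisym: "H = K" if "subgraph H K" "subgraph K H" for H K :: "('a, 'b) pre_digraph"
    using that by (auto simp: subgraph_def compatible_def intro: pre_digraph.equality)
  have "max_subgraph Digraph_Component.connected H \<longleftrightarrow> max_subgraph strongly_connected H" for H
  proof
    assume H: "max_subgraph Digraph_Component.connected H"
    then have H': "subgraph H G" "Digraph_Component.connected H"
      and max: "\<And>K. subgraph H K \<Longrightarrow> subgraph K G \<Longrightarrow> Digraph_Component.connected K \<Longrightarrow> K = H"
      unfolding max_subgraph_def by auto
    from strong[OF H'] obtain K
      where K: "subgraph H K" "induced_subgraph K G" "strongly_connected K"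
      by (elim exE conjE)
    have "K = H"
      by (rule max[OF K(1) sub[OF K(2)] conn[OF sub[OF K(2)] K(3)]])
    with K(3) have "strongly_connected H"
      by simp
    then show "max_subgraph strongly_connected H"
      unfolding max_subgraph_def using H'(1) max conn by metis
  next
    assume H: "max_subgraph strongly_connected H"
    then have H': "subgraph H G" "strongly_connected H"
      and max: "\<And>K. subgraph H K \<Longrightarrow> subgraph K G \<Longrightarrow> strongly_connected K \<Longrightarrow> K = H"
      unfolding max_subgraph_def by auto
    have "H' = H"
      if H'': "subgraph H H'" "subgraph H' G" "Digraph_Component.connected H'" for H'
    proof -
      from strong[OF H''(2,3)] obtain K
        where K: "subgraph H' K" "induced_subgraph K G" "strongly_connected K"
        by (elim exE conjE)
      have "K = H"
        by (rule max[OF trans[OF H''(1) K(1)] sub[OF K(2)] K(3)])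
      with K(1) have "subgraph H' H"
        by simp
      then show "H' = H"
        using H''(1) by (rule antisym)
    qed
    then show "max_subgraph Digraph_Component.connected H"
      unfolding max_subgraph_def using H'(1) conn[OF H'] by metis
  qed
  then show ?thesis
    unfolding connected_components_def sccs_altdef2 by (intro set_eqI) simp
qed

section \<open>The equivalence relation\<close>

text \<open>
  Concatenation of an element of \<open>{0,1}\<^sup>* \<union> {*}\<close> with a binary sequence, where \<open>*0 = *1\<close> is the
  null sequence: the symbol \<open>*\<close> absorbs the bit that follows it.
\<close>

fun star_append :: "bool list option \<Rightarrow> bool list \<Rightarrow> bool list option" where
  "star_append (Some \<alpha>) \<beta> = Some (\<alpha> @ \<beta>)"
| "star_append None [] = None"
| "star_append None (_ # \<beta>) = Some \<beta>"

text \<open>Sequences \<open>s\<^sub>1, s\<^sub>2, \<dots>\<close> are indexed from 1; the value of the function at 0 is never used.\<close>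

primrec \<mu> :: "nat \<Rightarrow> (nat \<Rightarrow> nat) \<Rightarrow> nat \<Rightarrow> bool list option" where
  "\<mu> a s 0 = None"
| "\<mu> a s (Suc i) =
     star_append (\<mu> a s i)
       (if odd (Suc i + a) then True # replicate (s (Suc i)) False
        else False # replicate (s (Suc i)) True)"

text \<open>
  The last clause speaks about the least index \<open>m\<close> at which \<open>(s\<^sub>1, \<dots>, s\<^sub>n, 0)\<close> and
  \<open>(s'\<^sub>1, \<dots>, s'\<^sub>n, 0)\<close> differ, and is vacuous if they are equal. As both end in 0, \<open>m \<le> n\<close>, so
  that \<open>n - m\<close> is not truncated.
\<close>

definition bowtie :: "bool list set \<Rightarrow> nat \<Rightarrow> bool list \<Rightarrow> bool list \<Rightarrow> bool" where
  "bowtie \<Omega> q \<alpha> \<beta> \<longleftrightarrow>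
     (\<exists>n s s' s''. \<exists>a \<in> {0, 1}. \<exists>b \<in> {0, 1}.
        1 \<le> n \<and> s (n + 1) = 0 \<and> s' (n + 1) = 0 \<and> s'' (n + 1) = 0 \<and>
        (\<forall>i \<in> {1..n}. [s i = s' i] (mod (q - 1)) \<and> [s' i = s'' (n + 1 - i)] (mod (q - 1))) \<and>
        (\<forall>i. 1 < i \<and> i < n \<and> Min {s i, s' i, s'' (n + 1 - i)} = 0 \<longrightarrow>
           s i = s' i \<and> s' i = s'' (n + 1 - i)) \<and>
        (a = b \<longleftrightarrow> odd n) \<and>
        Some \<alpha> = \<mu> a s (n + 1) \<and>
        (Some \<beta> = \<mu> a s' (n + 1) \<or> Some \<beta> = \<mu> b s'' (n + 1)) \<and>
        (\<forall>m \<in> {1..n + 1}. s m \<noteq> s' m \<and> (\<forall>i \<in> {1..<m}. s i = s' i) \<longrightarrow>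
           \<mu> b s'' (n - m) \<in> with_star \<Omega>))"

definition bowtie_rel :: "bool list set \<Rightarrow> nat \<Rightarrow> bool list rel" where
  "bowtie_rel \<Omega> q = {(\<alpha>, \<beta>). \<alpha> \<in> nonnull \<Omega> \<and> \<beta> \<in> nonnull \<Omega> \<and> bowtie \<Omega> q \<alpha> \<beta>}"

definition hbar :: "bool list set \<Rightarrow> nat \<Rightarrow> nat" where
  "hbar \<Omega> q = card (nonnull \<Omega> // bowtie_rel \<Omega> q)"

end

theory Submission
  imports Defs
begin

text \<open>
  Walk in the graph and watch the coordinates. Changing \<open>[l]\<close> to another neighbour of the same
  \<open>\<langle>r\<rangle>\<close> changes them by

    \<open>\<Delta>l\<^sub>\<eta> = r\<^sub>* \<Delta>l\<^sub>*\<close>,  \<open>\<Delta>l\<^sub>\<alpha>\<^sub>0 = r\<^sub>* \<Delta>l\<^sub>\<alpha>\<close>,  \<open>\<Delta>l\<^sub>\<beta>\<^sub>1 = r\<^sub>\<beta> \<Delta>l\<^sub>*\<close>,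

  and symmetrically on the other side. So the coordinate at \<open>\<mu>\<^sub>a\<^sub>,\<^sub>k(s)\<close>, taken on the appropriate
  side, is an iterated integral along the walk, with integrands \<open>r\<^sub>*\<^sup>s dl\<^sub>*\<close> and \<open>l\<^sub>*\<^sup>s dr\<^sub>*\<close>
  in turn, the exponents \<open>s\<close> being \<open>s\<^sub>k, \<dots>, s\<^sub>1\<close>
  from the outside to the inside. Two observations relate such integrals. The exponents matter only
  modulo \<open>q - 1\<close>, except that exponent 0 differs from \<open>q - 1\<close> at the argument 0. And integration
  by parts, which is exact because every step moves only one side, turns an iterated integral
  into the one with the integrands in reverse order, up to products of coordinates of words
  with fewer runs. These are the two ways in which \<open>\<bowtie>\<close> relates words: it replaces run lengths by
  congruent ones, and it reverses the sequence of runs. Accordingly, for \<open>\<alpha> \<bowtie> \<beta>\<close> there is a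
  function of the edges that is constant on components and equals
  \<open>x\<^sub>\<alpha> \<plusminus> x\<^sub>\<beta>\<close> plus a polynomial in coordinates of words with fewer runs, where \<open>x\<^sub>\<alpha>\<close> is a
  coordinate at \<open>\<alpha>\<close> (\<open>reversed_words_dependent\<close>, \<open>congruent_words_dependent\<close>).

  Hence, by induction on the number of runs, within one component an edge is determined by \<open>l\<^sub>*\<close>,
  \<open>r\<^sub>*\<close>, \<open>l\<^sub>\<eta>\<close> and one coordinate per equivalence class (\<open>linked_flags_equal\<close>). A component
  thus has at most \<open>q\<^sup>3 q\<^sup>\<hbar>\<close> edges, of the \<open>q\<close> to the power \<open>|\<Omega>| + 2 = |\<Omega>\<^sup>*| + 3\<close> edges in all.
\<close>

section \<open>Flags and steps\<close>

text \<open>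
  A flag \<open>e\<close> is an edge, with \<open>e True\<close> its end in \<open>L(\<Omega>)\<close> and \<open>e False\<close> its end in \<open>R(\<Omega>)\<close>.
  Indexing the two sides by bits makes the two families of equations one, see
  \<open>flag_append\<close>: the graph is invariant under exchanging the sides and
  complementing all bits.
\<close>

definition is_flag :: "bool list set \<Rightarrow> (bool \<Rightarrow> bool list option \<Rightarrow> 'a::field) \<Rightarrow> bool" where
  "is_flag \<Omega> e \<longleftrightarrow> adjacent \<Omega> (e True) (e False)"

text \<open>
  One end of the flag stays. Connectedness is studied through sequences of such steps, because the
  functions that are constant on components involve both ends of an edge.
\<close>

definition flag_step ::
  "bool list set \<Rightarrow> bool \<Rightarrow> (bool \<Rightarrow> bool list option \<Rightarrow> 'a::field) \<Rightarrow>
   (bool \<Rightarrow> bool list option \<Rightarrow> 'a) \<Rightarrow> bool" where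
  "flag_step \<Omega> c e e' \<longleftrightarrow> is_flag \<Omega> e \<and> is_flag \<Omega> e' \<and> e (\<not> c) = e' (\<not> c)"

definition linked ::
  "bool list set \<Rightarrow> (bool \<Rightarrow> bool list option \<Rightarrow> 'a::field) \<Rightarrow>
   (bool \<Rightarrow> bool list option \<Rightarrow> 'a) \<Rightarrow> bool" where
  "linked \<Omega> = (\<lambda>e e'. \<exists>c. flag_step \<Omega> c e e')\<^sup>*\<^sup>*"

lemma linked_invariant:
  assumes "linked \<Omega> e e'" and "\<And>c e e'. flag_step \<Omega> c e e' \<Longrightarrow> F e = F e'"
  shows "F e = F e'"
  using assms(1) unfolding linked_def
  by (induction rule: rtranclp_induct) (auto dest: assms(2))

lemma flag_null:
  assumes "is_flag \<Omega> e"
  shows "e c (Some []) + e (\<not> c) (Some []) = e c None * e (\<not> c) None"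
  using assms by (cases c) (auto simp: is_flag_def adjacent_def algebra_simps)

lemma flag_append:
  assumes "is_flag \<Omega> e" and "w @ [c] \<in> \<Omega>"
  shows "e c (Some (w @ [c])) + e (\<not> c) (Some (w @ [c])) = e c None * e (\<not> c) (Some w)"
  using assms by (cases c) (auto simp: is_flag_def adjacent_def algebra_simps)

section \<open>Prefixes and runs\<close>

lemma Some_in_with_star [simp]: "Some w \<in> with_star \<Omega> \<longleftrightarrow> w \<in> \<Omega>"
  and None_in_with_star [simp]: "None \<in> with_star \<Omega>"
  by (auto simp: with_star_def)

lemma condition_C1_prefix:
  assumes "condition_C1 \<Omega>" "xs @ ys \<in> \<Omega>"
  shows "xs \<in> \<Omega>"
  using assms(2)
proof (induction ys rule: rev_induct)
  case (snoc y ys)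
  then have "butlast (xs @ ys @ [y]) \<in> \<Omega>"
    using assms(1) unfolding condition_C1_def by blast
  then show ?case
    using snoc.IH by (simp add: butlast_append)
qed simp

lemma star_append_prefix:
  assumes "condition_C1 \<Omega>" "star_append x (ys @ zs) \<in> with_star \<Omega>"
  shows "star_append x ys \<in> with_star \<Omega>"
proof (cases x)
  case None
  with assms show ?thesis by (cases ys) (auto intro: condition_C1_prefix)
next
  case (Some w)
  with assms show ?thesis by (auto intro: condition_C1_prefix[of _ _ zs])
qed

lemma star_append_Some_append:
  assumes "star_append x (y # ys) = Some v"
  shows "star_append x (y # ys @ zs) = Some (v @ zs)"
  using assms by (cases x) auto

lemma star_append_Cons_Some: "\<exists>v. star_append x (y # ys) = Some v"
  by (cases x) auto

lemma star_append_Nil [simp]: "star_append x [] = x"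
  by (cases x) auto

text \<open>Block \<open>i\<close> starts with the bit that names the side on which its coordinate is taken.\<close>

lemma \<mu>_Suc:
  "\<mu> a s (Suc i) =
     star_append (\<mu> a s i) (odd (Suc i + a) # replicate (s (Suc i)) (\<not> odd (Suc i + a)))"
  by (cases "odd (Suc i + a)") auto

declare \<mu>.simps(2) [simp del]

lemma \<mu>_mono:
  assumes "condition_C1 \<Omega>" "\<mu> a s k \<in> with_star \<Omega>" "j \<le> k"
  shows "\<mu> a s j \<in> with_star \<Omega>"
  using assms(3,2)
proof (induction k rule: dec_induct)
  case (step k)
  then show ?case
    using star_append_prefix[OF assms(1), of "\<mu> a s k" "[]"] by (simp add: \<mu>_Suc)
qed

lemma \<mu>_cong:
  assumes "\<And>i. 1 \<le> i \<Longrightarrow> i \<le> k \<Longrightarrow> s i = s' i"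
  shows "\<mu> a s k = \<mu> a s' k"
  using assms by (induction k) (simp_all add: \<mu>_Suc)

lemma \<mu>_Some: "1 \<le> k \<Longrightarrow> \<exists>w. \<mu> a s k = Some w"
  by (cases k) (auto simp: \<mu>_Suc star_append_Cons_Some simp del: replicate.simps)

text \<open>
  The words \<open>\<mu>\<^sub>a\<^sub>,\<^sub>n\<^sub>+\<^sub>1(s)\<close> with \<open>s\<^sub>n\<^sub>+\<^sub>1 = 0\<close> are the nonnull words, decomposed into \<open>n\<close>
  runs of lengths \<open>s\<^sub>1 + 1, \<dots>, s\<^sub>n + 1\<close>. Being related by \<open>\<bowtie>\<close> preserves the number of runs.
\<close>

definition runs :: "bool list \<Rightarrow> nat" where
  "runs w = length (remdups_adj w)"

lemma runs_butlast_le: "runs w \<le> runs (w @ [x])"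
  by (cases w rule: rev_cases) (auto simp: runs_def remdups_adj_append_two)

text \<open>
  This is what appending one block of \<open>\<mu>\<close> does: \<open>x\<close> completes the last run, and the bits after it,
  with one more supplied by the next block, form a new run.
\<close>

lemma runs_new_run: "runs (v @ x # replicate (Suc t) (\<not> x)) = Suc (runs (v @ [x]))"
proof (induction t)
  case 0
  show ?case by (simp add: runs_def remdups_adj_append_two)
next
  case (Suc t)
  have "v @ x # replicate (Suc (Suc t)) (\<not> x) = (v @ x # replicate t (\<not> x)) @ [\<not> x, \<not> x]"
    and "v @ x # replicate (Suc t) (\<not> x) = (v @ x # replicate t (\<not> x)) @ [\<not> x]"
    by (simp_all flip: replicate_append_same)
  then show ?case
    using Suc unfolding runs_def by (simp only: remdups_adj_append_two) simp
qed

lemma runs_\<mu>_snoc: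
  assumes "\<mu> a s k = Some w"
  shows "runs (w @ [even (k + a)]) = k"
  using assms
proof (induction k arbitrary: w)
  case (Suc k)
  let ?d = "odd (Suc k + a)"
  show ?case
  proof (cases "\<mu> a s k")
    case None
    then have "k = 0"
      using \<mu>_Some[of k a s] by (cases k) auto
    have w: "w = replicate (s (Suc k)) (\<not> ?d)"
      using Suc.prems None by (simp add: \<mu>_Suc)
    have "w @ [\<not> ?d] = replicate (Suc (s (Suc k))) (\<not> ?d)"
      by (simp add: w replicate_append_same)
    then have "runs (w @ [\<not> ?d]) = 1"
      unfolding runs_def by (simp only: remdups_adj_replicate) simp
    then show ?thesis
      using \<open>k = 0\<close> by simp
  next
    case (Some v)
    then have "w = v @ ?d # replicate (s (Suc k)) (\<not> ?d)"
      using Suc.prems by (simp add: \<mu>_Suc)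
    then have "w @ [\<not> ?d] = v @ ?d # replicate (Suc (s (Suc k))) (\<not> ?d)"
      by (simp add: replicate_append_same)
    then have "runs (w @ [\<not> ?d]) = Suc (runs (v @ [?d]))"
      by (simp only: runs_new_run)
    with Suc.IH[OF Some] show ?thesis by simp
  qed
qed simp

lemma runs_\<mu>_le:
  assumes "\<mu> a s k = Some w"
  shows "runs w \<le> k"
  using runs_\<mu>_snoc[OF assms] runs_butlast_le[of w "even (k + a)"] by simp

lemma \<mu>_final:
  assumes "\<mu> a s (n + 1) = Some \<alpha>" "s (n + 1) = 0" "1 \<le> n"
  obtains w where "\<mu> a s n = Some w" "\<alpha> = w @ [even (n + a)]"
proof -
  obtain w where "\<mu> a s n = Some w"
    using \<mu>_Some assms(3) by blast
  with assms that show ?thesis by (simp add: \<mu>_Suc)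
qed

lemma runs_\<mu>_final:
  assumes "\<mu> a s (n + 1) = Some \<alpha>" "s (n + 1) = 0" "1 \<le> n"
  shows "runs \<alpha> = n"
  using \<mu>_final[OF assms] runs_\<mu>_snoc by metis

lemma run_decomposition:
  assumes "\<alpha> \<noteq> []"
  shows "\<exists>a\<in>{0, 1}. \<exists>n s. 1 \<le> n \<and> s (n + 1) = 0 \<and> \<mu> a s (n + 1) = Some \<alpha>"
  using assms
proof (induction \<alpha> rule: rev_nonempty_induct)
  case (single x)
  have "\<mu> (if x then 1 else 0) (\<lambda>_. 0) (1 + 1) = Some [x]"
    by (simp add: \<mu>_Suc)
  then show ?case
    by (intro bexI[of _ "if x then 1 else 0"] exI[of _ 1] exI[of _ "\<lambda>_. 0"]) auto
next
  case (snoc x \<alpha>)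
  then obtain a n s where a: "a \<in> {0, 1}" and n: "1 \<le> n" and s: "s (n + 1) = 0"
    and \<alpha>: "\<mu> a s (n + 1) = Some \<alpha>"
    by blast
  from \<mu>_final[OF \<alpha> s n] obtain w
    where w: "\<mu> a s n = Some w" "\<alpha> = w @ [even (n + a)]" .
  obtain k where k: "n = Suc k"
    using n by (cases n) auto
  show ?case
  proof (cases "x = even (n + a)")
    case True
    \<comment> \<open>The bit prolongs the last run.\<close>
    let ?s = "s(n := Suc (s n))"
    have "\<mu> a ?s k = \<mu> a s k"
      by (rule \<mu>_cong) (auto simp: k)
    moreover have "star_append (\<mu> a s k) (odd (n + a) # replicate (s n) (\<not> odd (n + a))) = Some w"
      using w(1) by (simp add: k \<mu>_Suc)
    ultimately have "\<mu> a ?s n = Some (w @ [\<not> odd (n + a)])"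
      using star_append_Some_append[of "\<mu> a s k" "odd (n + a)"
          "replicate (s n) (\<not> odd (n + a))" w "[\<not> odd (n + a)]"]
      unfolding k by (simp add: \<mu>_Suc replicate_append_same del: even_Suc even_add odd_add)
    then have "\<mu> a ?s (n + 1) = Some (\<alpha> @ [x])"
      using s w(2) True by (simp add: \<mu>_Suc)
    moreover have "?s (n + 1) = 0"
      using s by simp
    ultimately show ?thesis
      using a n by blast
  next
    case False
    let ?s = "s(n + 2 := 0)"
    have "\<mu> a ?s (n + 1) = \<mu> a s (n + 1)"
      by (rule \<mu>_cong) auto
    then have "\<mu> a ?s (n + 1 + 1) = Some (\<alpha> @ [x])"
      using \<alpha> False by (simp add: \<mu>_Suc)
    moreover have "?s (n + 1 + 1) = 0" "1 \<le> n + 1"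
      by simp_all
    ultimately show ?thesis
      using a by blast
  qed
qed

lemma bowtie_refl:
  assumes "\<alpha> \<noteq> []"
  shows "bowtie \<Omega> q \<alpha> \<alpha>"
proof -
  from run_decomposition[OF assms] obtain a n s
    where a: "a \<in> {0, 1}" and n: "1 \<le> n" and s: "s (n + 1) = 0" and \<alpha>: "\<mu> a s (n + 1) = Some \<alpha>"
    by blast
  let ?t = "\<lambda>i. if i = n + 1 then 0 else s (n + 1 - i)"
  have "?t (n + 1 - i) = s i" if "1 \<le> i" "i \<le> n" for i
    using that by auto
  moreover obtain b :: nat where "b \<in> {0, 1}" "a = b \<longleftrightarrow> odd n"
    using a by (cases "odd n") auto
  ultimately show ?thesis
    unfolding bowtie_def using a n s \<alpha>
    by (intro exI[of _ n] exI[of _ s] exI[of _ ?t] bexI[of _ a] bexI[of _ b]) auto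
qed


section \<open>Powers in a finite field\<close>

lemma finite_field_power_card_minus_one:
  fixes y :: "'a::{field,finite}"
  assumes "y \<noteq> 0"
  shows "y ^ (card (UNIV :: 'a set) - 1) = 1"
proof -
  have "bij_betw ((*) y) (- {0}) (- {0})"
    by (rule bij_betw_byWitness[where f' = "(*) (inverse y)"]) (use assms in auto)
  then have "(\<Prod>x\<in>- {0}. y * x) = (\<Prod>x\<in>- {0}. x)"
    by (rule prod.reindex_bij_betw)
  then have "y ^ card (- {0 :: 'a}) * (\<Prod>x\<in>- {0}. x) = 1 * (\<Prod>x\<in>- {0 :: 'a}. x)"
    by (simp add: prod.distrib)
  then have "y ^ card (- {0 :: 'a}) = 1"
    by (subst (asm) mult_cancel_right) auto
  then show ?thesis
    by (simp add: Compl_eq_Diff_UNIV card_Diff_singleton)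
qed

text \<open>
  The residue of a positive exponent modulo \<open>q - 1\<close> determines the power, even at 0. The exponents
  0 and \<open>q - 1\<close> differ at 0 only, which is harmless next to another factor \<open>y\<close>.
\<close>

lemma mult_power_cong:
  fixes v y :: "'a::{field,finite}"
  assumes "[i = j] (mod (card (UNIV :: 'a set) - 1))" and "(i = 0 \<longleftrightarrow> j = 0) \<or> v = y"
  shows "v * y ^ i = v * y ^ j"
proof (cases "y = 0")
  case True
  then show ?thesis using assms(2) by (auto simp: power_0_left)
next
  case False
  have *: "y ^ k = y ^ (k mod (card (UNIV :: 'a set) - 1))" for k
  proof -
    have "y ^ k = y ^ ((card (UNIV :: 'a set) - 1) * (k div (card (UNIV :: 'a set) - 1)) + k mod (card (UNIV :: 'a set) - 1))"
      by simp
    also have "\<dots> = y ^ (k mod (card (UNIV :: 'a set) - 1))"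
      unfolding power_add power_mult using finite_field_power_card_minus_one[OF False] by simp
    finally show ?thesis .
  qed
  show ?thesis
    using assms(1) *[of i] *[of j] by (simp add: cong_def)
qed

section \<open>How the coordinates change in a step\<close>

definition chain ::
  "(bool \<Rightarrow> bool list option \<Rightarrow> 'a) \<Rightarrow> nat \<Rightarrow> (nat \<Rightarrow> nat) \<Rightarrow> nat \<Rightarrow> 'a" where
  "chain e a s k = e (odd (k + a)) (\<mu> a s k)"

text \<open>
  Each of the two coordinates at a word determines the other one from coordinates at a prefix.
  On the side opposite to the last bit, the coordinate needs no correction by a
  product \<open>chain e a s n * chain e b t 0\<close> of coordinates at words that may have as many runs.
\<close>

definition cocoord :: "(bool \<Rightarrow> bool list option \<Rightarrow> 'a) \<Rightarrow> bool list \<Rightarrow> 'a" where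
  "cocoord e \<alpha> = e (\<not> last \<alpha>) (Some \<alpha>)"

text \<open>
  The bit \<open>c\<close> multiplies the coordinate at \<open>x\<close> on the fixed side by \<open>\<Delta>\<close>, and every further
  bit \<open>\<not> c\<close> multiplies the change by the fixed end's entry at \<open>*\<close>. The convention
  \<open>*0 = *1 = \<eta>\<close> makes the equation at the null sequence an instance of this.
\<close>

lemma flag_step_change:
  fixes e e' :: "bool \<Rightarrow> bool list option \<Rightarrow> 'a::field"
  assumes "condition_C1 \<Omega>" "flag_step \<Omega> c e e'"
    and "star_append x (c # replicate t (\<not> c)) \<in> with_star \<Omega>" (is "?w t \<in> _")
  shows "e' c (?w t) - e c (?w t) = e (\<not> c) x * e (\<not> c) None ^ t * (e' c None - e c None)"
  using assms(3)
proof (induction t)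
  case 0
  have flags: "is_flag \<Omega> e" "is_flag \<Omega> e'" "e' (\<not> c) = e (\<not> c)"
    using assms(2) by (auto simp: flag_step_def)
  show ?case
  proof (cases x)
    case None
    have "f c (Some []) = f c None * f (\<not> c) None - f (\<not> c) (Some [])"
      if "is_flag \<Omega> f" for f :: "bool \<Rightarrow> bool list option \<Rightarrow> 'a"
      using flag_null[OF that, of c] by (simp only: eq_diff_eq)
    from this[OF flags(1)] this[OF flags(2)] None show ?thesis
      using flags(3) by (simp add: right_diff_distrib mult.commute)
  next
    case (Some v)
    with 0 have "v @ [c] \<in> \<Omega>" by simp
    then have "f c (Some (v @ [c])) = f c None * f (\<not> c) (Some v) - f (\<not> c) (Some (v @ [c]))"
      if "is_flag \<Omega> f" for f :: "bool \<Rightarrow> bool list option \<Rightarrow> 'a"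
      using flag_append[OF that, of v c] by (simp only: eq_diff_eq)
    from this[OF flags(1)] this[OF flags(2)] Some show ?thesis
      using flags(3) by (simp add: right_diff_distrib mult.commute)
  qed
next
  case (Suc t)
  have flags: "is_flag \<Omega> e" "is_flag \<Omega> e'" "e' (\<not> c) = e (\<not> c)"
    using assms(2) by (auto simp: flag_step_def)
  obtain v where v: "?w t = Some v"
    using star_append_Cons_Some by blast
  then have w: "?w (Suc t) = Some (v @ [\<not> c])"
    using star_append_Some_append[OF v, of "[\<not> c]"] by (simp add: replicate_append_same)
  with Suc.prems have "v @ [\<not> c] \<in> \<Omega>" by simp
  then have "v \<in> \<Omega>"
    using condition_C1_prefix assms(1) by blast
  have "f c (Some (v @ [\<not> c])) = f (\<not> c) None * f c (Some v) - f (\<not> c) (Some (v @ [\<not> c]))"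
    if "is_flag \<Omega> f" for f :: "bool \<Rightarrow> bool list option \<Rightarrow> 'a"
    using flag_append[OF that \<open>v @ [\<not> c] \<in> \<Omega>\<close>] by (simp add: eq_diff_eq add.commute)
  from this[OF flags(1)] this[OF flags(2)]
  have "e' c (Some (v @ [\<not> c])) - e c (Some (v @ [\<not> c]))
      = e (\<not> c) None * (e' c (Some v) - e c (Some v))"
    using flags(3) by (simp add: right_diff_distrib)
  moreover have "e' c (Some v) - e c (Some v)
      = e (\<not> c) x * e (\<not> c) None ^ t * (e' c None - e c None)"
    using Suc.IH \<open>v \<in> \<Omega>\<close> unfolding v by simp
  ultimately show ?case
    unfolding w by simp
qed

lemma chain_step:
  fixes e e' :: "bool \<Rightarrow> bool list option \<Rightarrow> 'a::field"
  assumes "condition_C1 \<Omega>" "flag_step \<Omega> c e e'" "\<mu> a s (Suc k) \<in> with_star \<Omega>"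
  shows "chain e' a s (Suc k) - chain e a s (Suc k) =
    (if c = odd (Suc k + a)
     then chain e a s k * e (\<not> c) None ^ s (Suc k) * (e' c None - e c None) else 0)"
proof (cases "c = odd (Suc k + a)")
  case True
  then have "odd (k + a) = (\<not> c)" by simp
  with True show ?thesis
    using flag_step_change[OF assms(1,2), of "\<mu> a s k" "s (Suc k)"] assms(3)
    by (simp only: chain_def \<mu>_Suc) simp
next
  case False
  then have "odd (Suc k + a) = (\<not> c)" by simp
  then show ?thesis
    using assms(2) False by (simp add: chain_def flag_step_def)
qed

lemma chain_other_side:
  assumes "flag_step \<Omega> c e e'" "c \<noteq> odd (k + a)"
  shows "chain e' a s k = chain e a s k"
proof -
  from assms(2) have "odd (k + a) = (\<not> c)" by simp
  then show ?thesis
    using assms(1) by (simp add: chain_def flag_step_def)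
qed

text \<open>
  The last bit of \<open>\<alpha>\<close> belongs to its last run, so on the side opposite to that bit the coordinate at
  \<open>\<alpha>\<close> changes like \<open>chain e a s n\<close> with one more factor.
\<close>

lemma cocoord_step:
  fixes e e' :: "bool \<Rightarrow> bool list option \<Rightarrow> 'a::field"
  assumes "condition_C1 \<Omega>" "flag_step \<Omega> c e e'"
    and "\<mu> a s (n + 1) = Some \<alpha>" "s (n + 1) = 0" "1 \<le> n" "\<alpha> \<in> \<Omega>"
  shows "cocoord e' \<alpha> - cocoord e \<alpha> =
    (if c = odd (n + a)
     then chain e a s (n - 1) * e (\<not> c) None ^ Suc (s n) * (e' c None - e c None) else 0)"
proof -
  obtain k where k: "n = Suc k"
    using assms(5) by (cases n) auto
  define s' where "s' = s(n := Suc (s n))"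
  have prefix: "\<mu> a s' k = \<mu> a s k"
    by (rule \<mu>_cong) (auto simp: s'_def k)
  from \<mu>_final[OF assms(3-5)] obtain w
    where w: "\<mu> a s n = Some w" "\<alpha> = w @ [even (n + a)]" .
  have "star_append (\<mu> a s k) (odd (n + a) # replicate (s n) (\<not> odd (n + a))) = Some w"
    using w(1) by (simp add: k \<mu>_Suc)
  from star_append_Some_append[OF this, of "[\<not> odd (n + a)]"]
  have \<alpha>: "\<mu> a s' n = Some \<alpha>"
    using w(2) prefix
    unfolding k by (simp add: \<mu>_Suc s'_def k replicate_append_same del: even_Suc even_add odd_add)
  then have "chain e a s' n = cocoord e \<alpha>" for e :: "bool \<Rightarrow> bool list option \<Rightarrow> 'a"
    using w(2) by (simp add: chain_def cocoord_def)
  moreover have "chain e a s' k = chain e a s k"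
    by (simp add: chain_def prefix)
  moreover have "s' n = Suc (s n)"
    by (simp add: s'_def)
  moreover have "\<mu> a s' n \<in> with_star \<Omega>"
    by (simp add: \<alpha> assms(6))
  ultimately show ?thesis
    using chain_step[OF assms(1,2), of a s' k] unfolding k by (simp only: diff_Suc_1)
qed

text \<open>
  The partial sums of a repeated integration by parts. A summand multiplies coordinates on opposite
  sides when \<open>a + b + n\<close> is odd, so that a step changes only one of the two factors.
\<close>

definition mixed_sum ::
  "(bool \<Rightarrow> bool list option \<Rightarrow> 'a::field) \<Rightarrow> bool list \<Rightarrow> nat \<Rightarrow> (nat \<Rightarrow> nat) \<Rightarrow> nat \<Rightarrow>
   (nat \<Rightarrow> nat) \<Rightarrow> nat \<Rightarrow> nat \<Rightarrow> 'a" where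
  "mixed_sum e \<alpha> a s b t n j =
     cocoord e \<alpha> + (\<Sum>i = 1..j. (- 1) ^ i * chain e a s (n - i) * chain e b t i)"

text \<open>
  A product in the sum changes through its first factor in the steps on one side and through its
  second factor in those on the other side. When the exponents match, the second kind of change cancels
  the first kind of change of the preceding product, so the sum telescopes and only the last
  product contributes.
\<close>

lemma mixed_sum_step:
  fixes e e' :: "bool \<Rightarrow> bool list option \<Rightarrow> 'a::{field,finite}"
  assumes C1: "condition_C1 \<Omega>" and step: "flag_step \<Omega> c e e'"
    and \<alpha>: "\<mu> a s (n + 1) = Some \<alpha>" "s (n + 1) = 0" "1 \<le> n" "\<alpha> \<in> \<Omega>"
    and "j < n" and "\<mu> b t j \<in> with_star \<Omega>" and parity: "odd (a + b + n)"
    and cong: "\<And>i. 1 \<le> i \<Longrightarrow> i \<le> n \<Longrightarrow> [s i = t (n + 1 - i)] (mod (card (UNIV :: 'a set) - 1))"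
    and zero: "\<And>i. 1 < i \<Longrightarrow> i < n \<Longrightarrow> s i = 0 \<longleftrightarrow> t (n + 1 - i) = 0"
  shows "mixed_sum e' \<alpha> a s b t n j - mixed_sum e \<alpha> a s b t n j =
    (if c = odd (n - j + a)
     then (- 1) ^ j * chain e a s (n - j - 1) * chain e b t j * e (\<not> c) None ^ s (n - j) *
       (e' c None - e c None)
     else 0)"
  using \<open>j < n\<close> \<open>\<mu> b t j \<in> with_star \<Omega>\<close>
proof (induction j)
  case 0
  have "chain e b t 0 = e (\<not> odd (n + a)) None"
    using parity by (cases "even a"; cases "even b"; cases "even n") (simp_all add: chain_def)
  then show ?case
    using cocoord_step[OF C1 step \<alpha>] by (auto simp: mixed_sum_def)
next
  case (Suc j)
  define k where "k = n - j - 2"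
  have n: "n - j = Suc (Suc k)" "n - Suc j = Suc k" "n = j + 2 + k"
    using Suc.prems(1) by (auto simp: k_def)
  have mem_t: "\<mu> b t j \<in> with_star \<Omega>"
    using \<mu>_mono[OF C1 Suc.prems(2)] by simp
  have mem_s: "\<mu> a s (Suc k) \<in> with_star \<Omega>"
    using \<mu>_mono[OF C1, of a s "n + 1" "Suc k"] \<alpha>(1,4) n by simp
  define y \<Delta> where "y = e (\<not> c) None" and "\<Delta> = e' c None - e c None"
  let ?u = "chain e a s" and ?v = "chain e b t" and ?u' = "chain e' a s" and ?v' = "chain e' b t"
  have IH: "mixed_sum e' \<alpha> a s b t n j - mixed_sum e \<alpha> a s b t n j =
    (if c = even (Suc k + a) then (- 1) ^ j * ?u (Suc k) * ?v j * y ^ s (Suc (Suc k)) * \<Delta> else 0)"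
  proof -
    have "n - j - 1 = Suc k"
      using n(1) by simp
    moreover have "odd (n - j + a) = even (Suc k + a)"
      unfolding n(1) by (simp only: add_Suc even_Suc not_not)
    ultimately show ?thesis
      using Suc.IH[OF Suc_lessD[OF Suc.prems(1)] mem_t] n(1) by (simp only: y_def \<Delta>_def)
  qed
  have diff: "mixed_sum f \<alpha> a s b t n (Suc j) =
      mixed_sum f \<alpha> a s b t n j - (- 1) ^ j * chain f a s (Suc k) * chain f b t (Suc j)"
    for f :: "bool \<Rightarrow> bool list option \<Rightarrow> 'a"
    by (simp add: mixed_sum_def n)
  have par: "odd (Suc j + b) = even (Suc k + a)"
    using parity unfolding n(3)
    by (cases "even a"; cases "even b"; cases "even j"; cases "even k") simp_all
  show ?case
  proof (cases "c = odd (Suc k + a)")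
    case True
    have "?u' (Suc k) = ?u (Suc k) + ?u k * y ^ s (Suc k) * \<Delta>"
      using chain_step[OF C1 step mem_s] True by (simp add: y_def \<Delta>_def algebra_simps)
    moreover have "?v' (Suc j) = ?v (Suc j)"
      using par True by (intro chain_other_side[OF step]) simp
    moreover have "c \<noteq> even (Suc k + a)"
      using True by blast
    then have "mixed_sum e' \<alpha> a s b t n j = mixed_sum e \<alpha> a s b t n j"
      using IH by (simp only: if_not_P right_minus_eq if_False)
    ultimately show ?thesis
      unfolding n(2) if_P[OF True] diff y_def[symmetric] \<Delta>_def[symmetric]
      by (simp add: algebra_simps)
  next
    case False
    then have c: "c = odd (Suc j + b)" "c = even (Suc k + a)"
      using par by auto
    have "?v' (Suc j) = ?v (Suc j) + ?v j * y ^ t (Suc j) * \<Delta>"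
      using chain_step[OF C1 step Suc.prems(2)] c(1) by (simp add: y_def \<Delta>_def algebra_simps)
    moreover have "?u' (Suc k) = ?u (Suc k)"
      using False by (intro chain_other_side[OF step])
    moreover have "?v j * y ^ s (Suc (Suc k)) = ?v j * y ^ t (Suc j)"
    proof (rule mult_power_cong)
      show "[s (Suc (Suc k)) = t (Suc j)] (mod (card (UNIV :: 'a set) - 1))"
        using cong[of "Suc (Suc k)"] n(3) by simp
      show "(s (Suc (Suc k)) = 0 \<longleftrightarrow> t (Suc j) = 0) \<or> ?v j = y"
      \<comment> \<open>The exponents \<open>s n\<close> and \<open>t 1\<close> need not vanish together, but there \<open>?v 0 = y\<close>.\<close>
      proof (cases j)
        case 0
        then show ?thesis
          using c(1) by (simp add: chain_def y_def)
      next
        case (Suc i)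
        then show ?thesis
          using zero[of "Suc (Suc k)"] n(3) by simp
      qed
    qed
    moreover have "mixed_sum e' \<alpha> a s b t n j
        = mixed_sum e \<alpha> a s b t n j + (- 1) ^ j * ?u (Suc k) * (?v j * y ^ s (Suc (Suc k))) * \<Delta>"
      using IH unfolding if_P[OF c(2)] by (simp add: algebra_simps)
    ultimately show ?thesis
      unfolding n(2) if_not_P[OF False] diff by (auto simp: algebra_simps)
  qed
qed


section \<open>Related words have dependent coordinates\<close>

text \<open>
  Words are compared by their number of runs, since a mixed sum may contain reversed words that are
  longer than \<open>\<alpha>\<close> but always have fewer runs.
\<close>

definition agree_below ::
  "bool list set \<Rightarrow> nat \<Rightarrow> (bool \<Rightarrow> bool list option \<Rightarrow> 'a) \<Rightarrow>
   (bool \<Rightarrow> bool list option \<Rightarrow> 'a) \<Rightarrow> bool" where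
  "agree_below \<Omega> n e e' \<longleftrightarrow> (\<forall>c. e c None = e' c None) \<and>
     (\<forall>c w. w \<in> \<Omega> \<longrightarrow> runs w < n \<longrightarrow> e c (Some w) = e' c (Some w))"

lemma chain_eq:
  assumes agree: "agree_below \<Omega> n e e'"
    and "\<mu> a s k \<in> with_star \<Omega>" "k < n"
  shows "chain e a s k = chain e' a s k"
proof (cases "\<mu> a s k")
  case None
  then show ?thesis by (use None agree in \<open>simp add: chain_def agree_below_def\<close>)
next
  case (Some w)
  then have "w \<in> \<Omega>" "runs w < n"
    using assms(2,3) runs_\<mu>_le[OF Some] by auto
  with Some agree show ?thesis by (simp add: chain_def agree_below_def)
qed

lemma mixed_sum_diff:
  assumes agree: "agree_below \<Omega> n e e'"
    and C1: "condition_C1 \<Omega>" and "\<mu> a s n \<in> with_star \<Omega>" "\<mu> b t j \<in> with_star \<Omega>" "j < n"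
  shows "mixed_sum e \<alpha> a s b t n j - mixed_sum e' \<alpha> a s b t n j = cocoord e \<alpha> - cocoord e' \<alpha>"
proof -
  have "chain e a s (n - i) = chain e' a s (n - i)" "chain e b t i = chain e' b t i"
    if "i \<in> {1..j}" for i
    using that assms(5) \<mu>_mono[OF C1 assms(3), of "n - i"] \<mu>_mono[OF C1 assms(4), of i]
    by (auto intro!: chain_eq[OF agree])
  then show ?thesis
    by (simp add: mixed_sum_def)
qed

text \<open>
  The complete integration by parts: the change left over by the mixed sum is that of the
  coordinate at the word with the runs reversed.
\<close>

lemma reversed_words_dependent:
  fixes e e' :: "bool \<Rightarrow> bool list option \<Rightarrow> 'a::{field,finite}"
  assumes C1: "condition_C1 \<Omega>" and linked: "linked \<Omega> e e'"
    and agree: "agree_below \<Omega> n e e'"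
    and n: "1 \<le> n" and parity: "odd (a + b + n)"
    and \<alpha>: "\<mu> a s (n + 1) = Some \<alpha>" "s (n + 1) = 0" "\<alpha> \<in> \<Omega>"
    and \<beta>: "\<mu> b t (n + 1) = Some \<beta>" "t (n + 1) = 0" "\<beta> \<in> \<Omega>"
    and cong: "\<And>i. 1 \<le> i \<Longrightarrow> i \<le> n \<Longrightarrow> [s i = t (n + 1 - i)] (mod (card (UNIV :: 'a set) - 1))"
    and zero: "\<And>i. 1 < i \<Longrightarrow> i < n \<Longrightarrow> s i = 0 \<longleftrightarrow> t (n + 1 - i) = 0"
    and eq: "cocoord e \<beta> = cocoord e' \<beta>"
  shows "cocoord e \<alpha> = cocoord e' \<alpha>"
proof -
  have t: "\<mu> b t k \<in> with_star \<Omega>" if "k \<le> n + 1" for k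
    using \<mu>_mono[OF C1 _ that] \<beta> by simp
  have s: "\<mu> a s n \<in> with_star \<Omega>"
    using \<mu>_mono[OF C1, of a s "n + 1" n] \<alpha> by simp
  define F where "F f = mixed_sum f \<alpha> a s b t n (n - 1) + (- 1) ^ n * cocoord f \<beta>"
    for f :: "bool \<Rightarrow> bool list option \<Rightarrow> 'a"
  have "F e = F e'"
  proof (rule linked_invariant[OF linked])
    fix c and f f' :: "bool \<Rightarrow> bool list option \<Rightarrow> 'a"
    assume step: "flag_step \<Omega> c f f'"
    define y \<Delta> where "y = f (\<not> c) None" and "\<Delta> = f' c None - f c None"
    have par: "odd (1 + a) = odd (n + b)"
      using parity by (cases "even a"; cases "even b"; cases "even n") simp_all
    have m: "mixed_sum f' \<alpha> a s b t n (n - 1) - mixed_sum f \<alpha> a s b t n (n - 1) =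
      (if c = odd (n + b)
       then (- 1) ^ (n - 1) * chain f b t (n - 1) * (chain f a s 0 * y ^ s 1) * \<Delta> else 0)"
      using mixed_sum_step[OF C1 step \<alpha>(1,2) n \<alpha>(3) _ t parity cong zero, of "n - 1"] n
      unfolding par[symmetric] by (simp add: y_def \<Delta>_def mult_ac)
    have c: "cocoord f' \<beta> - cocoord f \<beta> =
      (if c = odd (n + b) then chain f b t (n - 1) * (y * y ^ t n) * \<Delta> else 0)"
      using cocoord_step[OF C1 step \<beta>(1,2) n \<beta>(3)] by (simp only: y_def \<Delta>_def power_Suc)
    have "F f' - F f = 0"
    proof (cases "c = odd (n + b)")
      case True
      have "c = odd (1 + a)"
        using True par by simp
      then have "chain f a s 0 = y"
        by (simp add: chain_def y_def)
      moreover have "y * y ^ s 1 = y * y ^ t n"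
        using cong[of 1] n by (intro mult_power_cong) simp_all
      moreover have "(- 1) ^ n = - ((- 1) ^ (n - 1) :: 'a)"
        using n by (cases n) simp_all
      moreover have "F f' - F f
        = (mixed_sum f' \<alpha> a s b t n (n - 1) - mixed_sum f \<alpha> a s b t n (n - 1))
          + (- 1) ^ n * (cocoord f' \<beta> - cocoord f \<beta>)"
        by (simp add: F_def algebra_simps)
      ultimately show ?thesis
        unfolding m c if_P[OF True] by (auto simp: algebra_simps)
    next
      case False
      with m c show ?thesis
        unfolding if_not_P[OF False] by (simp add: F_def)
    qed
    then show "F f = F f'" by simp
  qed
  moreover have "n - 1 < n" "n - 1 \<le> n + 1"
    using n by simp_all
  ultimately show ?thesis
    using mixed_sum_diff[OF agree C1 s t[of "n - 1"], where \<alpha> = \<alpha>] eq by (simp add: F_def)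
qed

text \<open>
  Integrating both words by parts, starting from their last runs, down to run \<open>m\<close> leaves the same change
  twice, because the words share the coordinate before run \<open>m\<close> and the power \<open>y ^ s m\<close> equals
  \<open>y ^ s' m\<close>. The products use the reversed words only up to \<open>\<mu> b t (n - m)\<close>, which is why
  only this one has to lie in \<open>\<Omega> \<union> {*}\<close>.
\<close>

lemma congruent_words_dependent:
  fixes e e' :: "bool \<Rightarrow> bool list option \<Rightarrow> 'a::{field,finite}"
  assumes C1: "condition_C1 \<Omega>" and linked: "linked \<Omega> e e'"
    and agree: "agree_below \<Omega> n e e'"
    and m: "1 \<le> m" "m \<le> n" and parity: "odd (a + b + n)"
    and \<alpha>: "\<mu> a s (n + 1) = Some \<alpha>" "s (n + 1) = 0" "\<alpha> \<in> \<Omega>"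
    and \<beta>: "\<mu> a s' (n + 1) = Some \<beta>" "s' (n + 1) = 0" "\<beta> \<in> \<Omega>"
    and cong: "\<And>i. 1 \<le> i \<Longrightarrow> i \<le> n \<Longrightarrow> [s i = t (n + 1 - i)] (mod (card (UNIV :: 'a set) - 1))"
    and cong': "\<And>i. 1 \<le> i \<Longrightarrow> i \<le> n \<Longrightarrow> [s' i = t (n + 1 - i)] (mod (card (UNIV :: 'a set) - 1))"
    and zero: "\<And>i. 1 < i \<Longrightarrow> i < n \<Longrightarrow> s i = 0 \<longleftrightarrow> t (n + 1 - i) = 0"
    and zero': "\<And>i. 1 < i \<Longrightarrow> i < n \<Longrightarrow> s' i = 0 \<longleftrightarrow> t (n + 1 - i) = 0"
    and least: "\<And>i. 1 \<le> i \<Longrightarrow> i < m \<Longrightarrow> s i = s' i"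
    and t: "\<mu> b t (n - m) \<in> with_star \<Omega>"
    and eq: "cocoord e \<beta> = cocoord e' \<beta>"
  shows "cocoord e \<alpha> = cocoord e' \<alpha>"
proof -
  have n: "1 \<le> n" "n - m < n"
    using m by simp_all
  have s: "\<mu> a s n \<in> with_star \<Omega>" "\<mu> a s' n \<in> with_star \<Omega>"
    using \<mu>_mono[OF C1, of a _ "n + 1" n] \<alpha> \<beta> by simp_all
  define F where "F f = mixed_sum f \<alpha> a s b t n (n - m) - mixed_sum f \<beta> a s' b t n (n - m)"
    for f :: "bool \<Rightarrow> bool list option \<Rightarrow> 'a"
  have "F e = F e'"
  proof (rule linked_invariant[OF linked])
    fix c and f f' :: "bool \<Rightarrow> bool list option \<Rightarrow> 'a"
    assume step: "flag_step \<Omega> c f f'"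
    define y \<Delta> where "y = f (\<not> c) None" and "\<Delta> = f' c None - f c None"
    let ?u = "chain f a s (m - 1)" and ?v = "chain f b t (n - m)"
    have nm: "n - (n - m) = m"
      using m by simp
    have "\<mu> a s (m - 1) = \<mu> a s' (m - 1)"
      using least by (intro \<mu>_cong) auto
    then have u: "chain f a s' (m - 1) = ?u"
      by (simp add: chain_def)
    have d: "mixed_sum f' \<alpha> a s b t n (n - m) - mixed_sum f \<alpha> a s b t n (n - m) =
        (if c = odd (m + a) then (- 1) ^ (n - m) * (?u * ?v * y ^ s m) * \<Delta> else 0)"
      using mixed_sum_step[OF C1 step \<alpha>(1,2) n(1) \<alpha>(3) n(2) t parity cong zero]
      by (simp only: nm y_def \<Delta>_def mult.assoc)
    have d': "mixed_sum f' \<beta> a s' b t n (n - m) - mixed_sum f \<beta> a s' b t n (n - m) =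
        (if c = odd (m + a) then (- 1) ^ (n - m) * (?u * ?v * y ^ s' m) * \<Delta> else 0)"
      using mixed_sum_step[OF C1 step \<beta>(1,2) n(1) \<beta>(3) n(2) t parity cong' zero']
      by (simp only: nm y_def \<Delta>_def u mult.assoc)
    \<comment> \<open>The exponents of an outer run may vanish for one word only, but then \<open>y\<close> is a cofactor.\<close>
    have "?u * ?v * y ^ s m = ?u * ?v * y ^ s' m" if c: "c = odd (m + a)"
    proof -
      have sm: "[s m = s' m] (mod (card (UNIV :: 'a set) - 1))"
        using cong[OF m] cong'[OF m] cong_sym cong_trans by blast
      consider "m = 1" | "m = n" | "1 < m" "m < n"
        using m by linarith
      then show ?thesis
      proof cases
        case 1
        then have "?u = y"
          using c by (simp add: chain_def y_def)
        then have "?u * y ^ s m = ?u * y ^ s' m"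
          using sm by (intro mult_power_cong) simp_all
        then show ?thesis by (auto simp: mult_ac)
      next
        case 2
        have "(\<not> c) = odd b"
          using parity c unfolding 2 by (cases "even a"; cases "even b"; cases "even n") simp_all
        then have "?v = y"
          using 2 by (simp add: chain_def y_def)
        then have "?v * y ^ s m = ?v * y ^ s' m"
          using sm by (intro mult_power_cong) simp_all
        then show ?thesis by (auto simp: mult_ac)
      next
        case 3
        then show ?thesis
          using sm zero[OF 3] zero'[OF 3] by (intro mult_power_cong) simp_all
      qed
    qed
    then have "mixed_sum f' \<alpha> a s b t n (n - m) - mixed_sum f \<alpha> a s b t n (n - m)
        = mixed_sum f' \<beta> a s' b t n (n - m) - mixed_sum f \<beta> a s' b t n (n - m)"
      unfolding d d' by (cases "c = odd (m + a)") (simp_all only: if_True if_False)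
    then show "F f = F f'"
      by (simp add: F_def algebra_simps)
  qed
  then show ?thesis
    using mixed_sum_diff[OF agree C1 s(1) t n(2), where \<alpha> = \<alpha>]
      mixed_sum_diff[OF agree C1 s(2) t n(2), where \<alpha> = \<beta>] eq
    by (simp add: F_def algebra_simps)
qed

lemma bowtie_dependent:
  fixes e e' :: "bool \<Rightarrow> bool list option \<Rightarrow> 'a::{field,finite}"
  assumes C1: "condition_C1 \<Omega>" and linked: "linked \<Omega> e e'"
    and bowtie: "bowtie \<Omega> (card (UNIV :: 'a set)) \<alpha> \<beta>" and "\<alpha> \<in> \<Omega>" "\<beta> \<in> \<Omega>"
    and agree: "agree_below \<Omega> (runs \<alpha>) e e'"
    and eq: "cocoord e \<beta> = cocoord e' \<beta>"
  shows "cocoord e \<alpha> = cocoord e' \<alpha>"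
proof -
  let ?q = "card (UNIV :: 'a set)"
  from bowtie obtain n s s' s'' a b where ab: "a \<in> {0, 1}" "b \<in> {0, 1}" "a = b \<longleftrightarrow> odd n"
    and n: "1 \<le> n" and last: "s (n + 1) = 0" "s' (n + 1) = 0" "s'' (n + 1) = 0"
    and cong: "\<forall>i \<in> {1..n}. [s i = s' i] (mod (?q - 1)) \<and> [s' i = s'' (n + 1 - i)] (mod (?q - 1))"
    and zero: "\<forall>i. 1 < i \<and> i < n \<and> Min {s i, s' i, s'' (n + 1 - i)} = 0 \<longrightarrow>
           s i = s' i \<and> s' i = s'' (n + 1 - i)"
    and \<alpha>: "\<mu> a s (n + 1) = Some \<alpha>"
    and \<beta>: "\<mu> a s' (n + 1) = Some \<beta> \<or> \<mu> b s'' (n + 1) = Some \<beta>"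
    and m: "\<forall>m \<in> {1..n + 1}. s m \<noteq> s' m \<and> (\<forall>i \<in> {1..<m}. s i = s' i) \<longrightarrow>
           \<mu> b s'' (n - m) \<in> with_star \<Omega>"
    unfolding bowtie_def by (elim exE bexE conjE) (rule that, auto)
  have parity: "odd (a + b + n)"
    using ab by auto
  have agree: "agree_below \<Omega> n e e'"
    using agree runs_\<mu>_final[OF \<alpha> last(1) n] by simp
  have cong': "[s' i = s'' (n + 1 - i)] (mod (?q - 1))"
    and cong: "[s i = s'' (n + 1 - i)] (mod (?q - 1))" if "1 \<le> i" "i \<le> n" for i
    using cong that cong_trans by (fastforce, meson atLeastAtMost_iff cong_trans)
  have zero': "s' i = 0 \<longleftrightarrow> s'' (n + 1 - i) = 0"
    and zero: "s i = 0 \<longleftrightarrow> s'' (n + 1 - i) = 0" if "1 < i" "i < n" for i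
  proof -
    have *: "s i = 0 \<or> s' i = 0 \<or> s'' (n + 1 - i) = 0 \<Longrightarrow> s i = s' i \<and> s' i = s'' (n + 1 - i)"
      using zero that by (auto simp: min_def split: if_splits)
    then show "s' i = 0 \<longleftrightarrow> s'' (n + 1 - i) = 0" "s i = 0 \<longleftrightarrow> s'' (n + 1 - i) = 0"
      by metis+
  qed
  show ?thesis
  proof (cases "\<mu> b s'' (n + 1) = Some \<beta>")
    case True
    show ?thesis
      using reversed_words_dependent[OF C1 linked agree n parity \<alpha> last(1) \<open>\<alpha> \<in> \<Omega>\<close>
          True last(3) \<open>\<beta> \<in> \<Omega>\<close> cong zero eq] .
  next
    case False
    then have \<beta>: "\<mu> a s' (n + 1) = Some \<beta>"
      using \<beta> by blast
    show ?thesis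
    proof (cases "\<forall>i\<in>{1..n}. s i = s' i")
      case True
      then have "\<mu> a s (n + 1) = \<mu> a s' (n + 1)"
        using last by (intro \<mu>_cong) (metis Suc_eq_plus1 atLeastAtMost_iff le_Suc_eq)
      then show ?thesis
        using \<alpha> \<beta> eq by simp
    next
      case False
      define m where "m = (LEAST i. 1 \<le> i \<and> s i \<noteq> s' i)"
      from False obtain k where k: "1 \<le> k" "k \<le> n" "s k \<noteq> s' k"
        by auto
      have m1: "1 \<le> m" "s m \<noteq> s' m" "m \<le> k"
        using LeastI[of "\<lambda>i. 1 \<le> i \<and> s i \<noteq> s' i" k] Least_le[of "\<lambda>i. 1 \<le> i \<and> s i \<noteq> s' i" k] k
        unfolding m_def by auto
      have least: "s i = s' i" if "1 \<le> i" "i < m" for i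
        using not_less_Least[of i "\<lambda>i. 1 \<le> i \<and> s i \<noteq> s' i"] that unfolding m_def by blast
      have "m \<le> n"
        using m1 k by simp
      moreover have "\<mu> b s'' (n - m) \<in> with_star \<Omega>"
        using m m1 least \<open>m \<le> n\<close> by simp
      ultimately show ?thesis
        using congruent_words_dependent[OF C1 linked agree m1(1) _ parity \<alpha> last(1) \<open>\<alpha> \<in> \<Omega>\<close>
            \<beta> last(2) \<open>\<beta> \<in> \<Omega>\<close> cong cong' zero zero' least _ eq] by blast
    qed
  qed
qed


text \<open>
  Induction on the number of runs and then on the length: the coordinate at the representative
  fixes one coordinate at \<open>w\<close>, and the prefix of \<open>w\<close>, which has at most as many runs but is
  shorter, fixes the other.
\<close>

lemma linked_flags_equal:
  fixes e e' :: "bool \<Rightarrow> bool list option \<Rightarrow> 'a::{field,finite}"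
  assumes C1: "condition_C1 \<Omega>" and linked: "linked \<Omega> e e'"
    and flags: "is_flag \<Omega> e" "is_flag \<Omega> e'"
    and rep: "\<And>\<alpha>. \<alpha> \<in> nonnull \<Omega> \<Longrightarrow>
      \<exists>\<beta>\<in>S. \<beta> \<in> \<Omega> \<and> bowtie \<Omega> (card (UNIV :: 'a set)) \<alpha> \<beta>"
    and star: "\<And>c. e c None = e' c None"
    and null: "e True (Some []) = e' True (Some [])"
    and eq: "\<And>\<beta>. \<beta> \<in> S \<Longrightarrow> cocoord e \<beta> = cocoord e' \<beta>"
    and "w \<in> \<Omega>"
  shows "e c (Some w) = e' c (Some w)"
  using \<open>w \<in> \<Omega>\<close>
proof (induction w arbitrary: c rule: wf_induct_rule[OF wf_measures[of "[runs, length]"]])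
  case (1 w)
  show ?case
  proof (cases w rule: rev_cases)
    case Nil
    have "e False (Some []) = e True None * e False None - e True (Some [])"
      "e' False (Some []) = e' True None * e' False None - e' True (Some [])"
      using flag_null[OF flags(1), of True] flag_null[OF flags(2), of True]
      by (simp_all add: eq_diff_eq add.commute)
    with Nil null star show ?thesis by (cases c) simp_all
  next
    case (snoc v x)
    then have mem: "v @ [x] \<in> \<Omega>" "v \<in> \<Omega>"
      using 1(2) condition_C1_prefix[OF C1] by blast+
    have "agree_below \<Omega> (runs w) e e'"
      unfolding agree_below_def using star 1(1) by auto
    moreover obtain \<beta> where "\<beta> \<in> S" "\<beta> \<in> \<Omega>" "bowtie \<Omega> (card (UNIV :: 'a set)) w \<beta>"
      using rep[of w] 1(2) snoc by (auto simp: nonnull_def)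
    ultimately have "cocoord e w = cocoord e' w"
      using bowtie_dependent[OF C1 linked] 1(2) eq by blast
    then have co: "e (\<not> x) (Some w) = e' (\<not> x) (Some w)"
      by (simp add: cocoord_def snoc)
    have v: "e (\<not> x) (Some v) = e' (\<not> x) (Some v)"
      using runs_butlast_le[of v x] by (intro 1(1) mem) (auto simp: snoc)
    have "f x (Some w) = f x None * f (\<not> x) (Some v) - f (\<not> x) (Some w)"
      if "is_flag \<Omega> f" for f :: "bool \<Rightarrow> bool list option \<Rightarrow> 'a"
      using flag_append[OF that mem(1)] by (simp only: eq_diff_eq snoc)
    from this[OF flags(1)] this[OF flags(2)] co v star have "e x (Some w) = e' x (Some w)"
      by simp
    with co show ?thesis
      by (cases "c = x") auto
  qed
qed

section \<open>Counting flags\<close>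

definition flag_of :: "(bool list option \<Rightarrow> 'a) \<Rightarrow> (bool list option \<Rightarrow> 'a) \<Rightarrow> bool \<Rightarrow> bool list option \<Rightarrow> 'a"
  where "flag_of l r = (\<lambda>c. if c then l else r)"

definition flags :: "bool list set \<Rightarrow> ((bool list option \<Rightarrow> 'a::field) \<times> (bool list option \<Rightarrow> 'a)) set"
  where "flags \<Omega> = {(l, r). l \<in> vectors \<Omega> \<and> r \<in> vectors \<Omega> \<and> adjacent \<Omega> l r}"

fun incident ::
  "(bool list option \<Rightarrow> 'a) + (bool list option \<Rightarrow> 'a) \<Rightarrow> (bool \<Rightarrow> bool list option \<Rightarrow> 'a) \<Rightarrow> bool"
  where
  "incident (Inl l) e \<longleftrightarrow> e True = l"
| "incident (Inr r) e \<longleftrightarrow> e False = r"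

lemma incident_flags_linked:
  assumes "is_flag \<Omega> e" "is_flag \<Omega> e'" "incident v e" "incident v e'"
  shows "linked \<Omega> e e'"
proof -
  have "flag_step \<Omega> (case v of Inl _ \<Rightarrow> False | Inr _ \<Rightarrow> True) e e'"
    using assms by (cases v) (auto simp: flag_step_def)
  then show ?thesis
    unfolding linked_def by blast
qed

lemma reachable_flags_linked:
  assumes "u \<rightarrow>\<^sup>*\<^bsub>with_proj (\<Gamma> \<Omega>)\<^esub> v"
    and "is_flag \<Omega> e" "incident u e" "is_flag \<Omega> e'" "incident v e'"
  shows "linked \<Omega> e e'"
proof -
  have "pair_wf_digraph (\<Gamma> \<Omega>)"
    by unfold_locales (auto simp: \<Gamma>_def)
  then interpret pair_wf_digraph "\<Gamma> \<Omega>" .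
  show ?thesis
    using assms(1,4,5)
  proof (induction v arbitrary: e' rule: reachable_induct)
    case base
    then show ?case
      using assms(2,3) incident_flags_linked by blast
  next
    case (step x y)
    obtain f where f: "is_flag \<Omega> f" "incident x f" "incident y f"
    proof -
      from step.hyps(2) obtain l r
        where "adjacent \<Omega> l r" "x = Inl l \<and> y = Inr r \<or> x = Inr r \<and> y = Inl l"
        by (auto simp: \<Gamma>_def)
      then show thesis
        by (intro that[of "flag_of l r"]) (auto simp: is_flag_def flag_of_def)
    qed
    have "linked \<Omega> e f"
      using step.IH f(1,2) by blast
    moreover have "linked \<Omega> f e'"
      using incident_flags_linked f(1,3) step.prems by blast
    ultimately show ?case
      unfolding linked_def by simp
  qed
qed

text \<open>
  The vector with entry \<open>y\<close> at \<open>*\<close> that is adjacent to \<open>[l]\<close>; its entries are computed along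
  prefixes, so words are read here from their last bit.
\<close>

primrec neighbour :: "(bool list option \<Rightarrow> 'a::field) \<Rightarrow> 'a \<Rightarrow> bool list \<Rightarrow> 'a" where
  "neighbour l y [] = l None * y - l (Some [])"
| "neighbour l y (x # w) =
     (if x then l None * neighbour l y w else y * l (Some (rev w))) - l (Some (rev (x # w)))"

lemma neighbour_exists:
  assumes "condition_C1 \<Omega>"
  shows "\<exists>r\<in>vectors \<Omega>. adjacent \<Omega> l r \<and> r None = y"
proof -
  let ?r = "restrict (case_option y (\<lambda>w. neighbour l y (rev w))) (with_star \<Omega>)"
  have "[] \<in> \<Omega>"
    using assms by (simp add: condition_C1_def)
  then have "adjacent \<Omega> l ?r"
    using condition_C1_prefix[OF assms] by (auto simp: adjacent_def)
  then show ?thesis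
    by (intro bexI[of _ ?r]) (auto simp: vectors_def)
qed

lemma card_with_star: "finite \<Omega> \<Longrightarrow> card (with_star \<Omega>) = Suc (card \<Omega>)"
  unfolding with_star_def by (subst card_insert_disjoint) (auto simp: card_image)

lemma finite_vectors: "finite \<Omega> \<Longrightarrow> finite (vectors \<Omega> :: (_ \<Rightarrow> 'a::finite) set)"
  unfolding vectors_def with_star_def by (intro finite_PiE) auto

lemma card_flags:
  assumes "finite \<Omega>" "condition_C1 \<Omega>"
  shows "card (UNIV :: 'a set) ^ (card \<Omega> + 2)
    \<le> card (flags \<Omega> :: ((_ \<Rightarrow> 'a::{field,finite}) \<times> _) set)"
proof -
  let ?V = "vectors \<Omega> :: (_ \<Rightarrow> 'a) set"
  have "finite (flags \<Omega> :: ((_ \<Rightarrow> 'a) \<times> _) set)"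
    using finite_vectors[OF assms(1)] by (rule_tac finite_subset[of _ "?V \<times> ?V"]) (auto simp: flags_def)
  moreover have "?V \<times> UNIV \<subseteq> (\<lambda>(l, r). (l, r None)) ` flags \<Omega>"
  proof clarify
    fix l :: "bool list option \<Rightarrow> 'a" and y
    assume "l \<in> vectors \<Omega>"
    with neighbour_exists[OF assms(2), of l y] obtain r
      where "(l, r) \<in> flags \<Omega>" "r None = y"
      by (auto simp: flags_def)
    then show "(l, y) \<in> (\<lambda>(l, r). (l, r None)) ` flags \<Omega>"
      by force
  qed
  ultimately have "card (?V \<times> (UNIV :: 'a set)) \<le> card (flags \<Omega> :: ((_ \<Rightarrow> 'a) \<times> _) set)"
    by (rule surj_card_le)
  moreover have "card ?V = card (UNIV :: 'a set) ^ (card \<Omega> + 1)"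
    using assms(1) unfolding vectors_def
    by (subst card_PiE) (simp_all add: card_with_star, simp add: with_star_def)
  ultimately show ?thesis
    by (simp add: card_cartesian_product mult.commute)
qed

text \<open>
  Every set \<open>{\<beta>. \<alpha> \<bowtie> \<beta>}\<close> is nonempty by reflexivity; \<open>S\<close> takes one element from each.
\<close>

lemma bowtie_representatives:
  assumes "finite \<Omega>"
  obtains S where "S \<subseteq> nonnull \<Omega>" "card S \<le> hbar \<Omega> q"
    and "\<And>\<alpha>. \<alpha> \<in> nonnull \<Omega> \<Longrightarrow> \<exists>\<beta>\<in>S. \<beta> \<in> \<Omega> \<and> bowtie \<Omega> q \<alpha> \<beta>"
proof
  let ?R = "bowtie_rel \<Omega> q"
  let ?S = "(\<lambda>X. SOME \<beta>. \<beta> \<in> X) ` (nonnull \<Omega> // ?R)"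
  have R: "?R \<subseteq> nonnull \<Omega> \<times> nonnull \<Omega>"
    by (auto simp: bowtie_rel_def)
  have rep: "(\<alpha>, SOME \<beta>. \<beta> \<in> ?R `` {\<alpha>}) \<in> ?R" if "\<alpha> \<in> nonnull \<Omega>" for \<alpha>
  proof -
    have "(\<alpha>, \<alpha>) \<in> ?R"
      using that bowtie_refl by (auto simp: bowtie_rel_def nonnull_def)
    then show ?thesis
      by (metis Image_singleton_iff someI)
  qed
  then show "?S \<subseteq> nonnull \<Omega>"
    using R unfolding quotient_def by blast
  show "card ?S \<le> hbar \<Omega> q"
    unfolding hbar_def using assms R
    by (intro card_image_le finite_quotient) (auto simp: nonnull_def)
  show "\<exists>\<beta>\<in>?S. \<beta> \<in> \<Omega> \<and> bowtie \<Omega> q \<alpha> \<beta>" if "\<alpha> \<in> nonnull \<Omega>" for \<alpha>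
  proof
    show "(SOME \<beta>. \<beta> \<in> ?R `` {\<alpha>}) \<in> ?S"
      by (intro imageI quotientI that)
    show "(SOME \<beta>. \<beta> \<in> ?R `` {\<alpha>}) \<in> \<Omega> \<and> bowtie \<Omega> q \<alpha> (SOME \<beta>. \<beta> \<in> ?R `` {\<alpha>})"
      using rep[OF that] unfolding bowtie_rel_def nonnull_def by blast
  qed
qed

theorem corollary3:
  fixes \<Omega> :: "bool list set" and q :: nat
  assumes "q = card (UNIV :: 'a::{field,finite} set)"
    and "finite \<Omega>" and "condition_C1 \<Omega>"
  shows "card (connected_components
           (with_proj (\<Gamma> \<Omega> :: ((bool list option \<Rightarrow> 'a) + (bool list option \<Rightarrow> 'a)) pair_pre_digraph)))
         \<ge> q ^ (card (nonnull \<Omega>) - hbar \<Omega> q)"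
proof -
  let ?G = "\<Gamma> \<Omega> :: ((bool list option \<Rightarrow> 'a) + (bool list option \<Rightarrow> 'a)) pair_pre_digraph"
  interpret G: pair_graph ?G
    by (rule pair_graph_\<Gamma>[OF assms(2)])
  let ?C = "G.sccs_verts"
  obtain S where S: "S \<subseteq> nonnull \<Omega>" "card S \<le> hbar \<Omega> q"
    and rep: "\<And>\<alpha>. \<alpha> \<in> nonnull \<Omega> \<Longrightarrow> \<exists>\<beta>\<in>S. \<beta> \<in> \<Omega> \<and> bowtie \<Omega> q \<alpha> \<beta>"
    using bowtie_representatives[OF assms(2)] by blast
  have fin: "finite (nonnull \<Omega>)"
    using assms(2) by (simp add: nonnull_def)
  then have finS: "finite S"
    using S(1) finite_subset by blast
  \<comment> \<open>The component of a flag and the coordinates that determine it there.\<close>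
  define \<Phi> :: "(bool list option \<Rightarrow> 'a) \<times> (bool list option \<Rightarrow> 'a) \<Rightarrow> _" where
    "\<Phi> = (\<lambda>(l, r). (G.scc_of (Inl l), l None, r None, l (Some []), restrict (cocoord (flag_of l r)) S))"
  have verts: "Inl l \<in> pverts ?G" if "l \<in> vectors \<Omega>" for l
    using that by (simp add: \<Gamma>_def)
  have "inj_on \<Phi> (flags \<Omega>)"
  proof (rule inj_onI, clarify)
    fix l r l' r' :: "bool list option \<Rightarrow> 'a"
    assume mem: "(l, r) \<in> flags \<Omega>" "(l', r') \<in> flags \<Omega>" and eq: "\<Phi> (l, r) = \<Phi> (l', r')"
    let ?e = "flag_of l r" and ?e' = "flag_of l' r'"
    have flag: "is_flag \<Omega> ?e" "is_flag \<Omega> ?e'"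
      using mem by (auto simp: flags_def is_flag_def flag_of_def)
    have "Inl l' \<in> pverts ?G"
      using mem verts by (simp add: flags_def)
    then have "Inl l' \<in> G.scc_of (Inl l)"
      using eq G.in_scc_of_self[of "Inl l'"] by (simp add: \<Phi>_def)
    then have "Inl l \<rightarrow>\<^sup>*\<^bsub>with_proj ?G\<^esub> Inl l'"
      by (simp add: G.scc_of_def)
    then have linked: "linked \<Omega> ?e ?e'"
      by (rule reachable_flags_linked) (use flag in \<open>auto simp: flag_of_def\<close>)
    have star: "?e c None = ?e' c None" for c
      using eq by (auto simp: \<Phi>_def flag_of_def)
    have "cocoord ?e \<beta> = cocoord ?e' \<beta>" if "\<beta> \<in> S" for \<beta>
      using eq that by (auto simp: \<Phi>_def dest: fun_cong[where x = \<beta>])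
    moreover have "?e True (Some []) = ?e' True (Some [])"
      using eq by (simp add: \<Phi>_def flag_of_def)
    ultimately have words: "?e c (Some w) = ?e' c (Some w)" if "w \<in> \<Omega>" for c w
      using linked_flags_equal[OF assms(3) linked flag _ star _ _ that] rep assms(1) by blast
    have same: "?e c x = ?e' c x" if "x \<in> with_star \<Omega>" for c x
      using that star words by (cases x) simp_all
    have V: "l \<in> with_star \<Omega> \<rightarrow>\<^sub>E UNIV" "l' \<in> with_star \<Omega> \<rightarrow>\<^sub>E UNIV"
      "r \<in> with_star \<Omega> \<rightarrow>\<^sub>E UNIV" "r' \<in> with_star \<Omega> \<rightarrow>\<^sub>E UNIV"
      using mem by (simp_all add: flags_def vectors_def)
    show "l = l' \<and> r = r'"
      using same[of _ True] same[of _ False]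
      by (intro conjI PiE_ext[OF V(1,2)] PiE_ext[OF V(3,4)]) (simp_all add: flag_of_def)
  qed
  moreover have "\<Phi> ` flags \<Omega> \<subseteq> ?C \<times> UNIV \<times> UNIV \<times> UNIV \<times> (S \<rightarrow>\<^sub>E UNIV)"
    using verts by (auto simp: \<Phi>_def flags_def intro!: G.scc_of_in_sccs_verts)
  moreover have "finite (?C \<times> (UNIV :: 'a set) \<times> (UNIV :: 'a set) \<times> (UNIV :: 'a set) \<times>
      (S \<rightarrow>\<^sub>E (UNIV :: 'a set)))"
    using G.finite_sccs_verts finS by (intro finite_cartesian_product finite_PiE) auto
  ultimately have "card (flags \<Omega> :: ((_ \<Rightarrow> 'a) \<times> _) set) \<le>
      card (?C \<times> (UNIV :: 'a set) \<times> (UNIV :: 'a set) \<times> (UNIV :: 'a set) \<times>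
        (S \<rightarrow>\<^sub>E (UNIV :: 'a set)))"
    by (rule card_inj_on_le)
  also have "\<dots> = card ?C * q ^ (card S + 3)"
    using finS by (simp add: card_cartesian_product card_PiE assms(1) power_add power3_eq_cube)
  finally have "q ^ (card \<Omega> + 2) \<le> card ?C * q ^ (card S + 3)"
    using order_trans card_flags[OF assms(2,3), where 'a = 'a] unfolding assms(1) by blast
  moreover have "card \<Omega> + 2 = (card (nonnull \<Omega>) - card S) + (card S + 3)"
  proof -
    have "[] \<in> \<Omega>"
      using assms(3) by (simp add: condition_C1_def)
    then have "card \<Omega> = Suc (card (nonnull \<Omega>))"
      unfolding nonnull_def using assms(2) by (metis card_Suc_Diff1)
    then show ?thesis
      using card_mono[OF fin S(1)] by simp
  qed
  moreover have q: "q > 0"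
    using assms(1) by (simp add: finite_UNIV_card_ge_0)
  ultimately have "q ^ (card (nonnull \<Omega>) - card S) * q ^ (card S + 3) \<le> card ?C * q ^ (card S + 3)"
    by (simp only: power_add)
  with q have "q ^ (card (nonnull \<Omega>) - card S) \<le> card ?C"
    by (subst (asm) mult_le_cancel2) simp
  moreover have "q ^ (card (nonnull \<Omega>) - hbar \<Omega> q) \<le> q ^ (card (nonnull \<Omega>) - card S)"
    using S(2) q by (intro power_increasing) simp_all
  ultimately show ?thesis
    by (simp add: G.connected_components_eq_sccs flip: G.card_sccs_verts)
qed

end
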